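(* For every integer $i\ge 1$, $J(3i+1,\,2i)$ is positive and equals $\frac{3}{2}\binom{2i}{i}$.
   Context: Let $\pi=\pi_1\cdots\pi_n$ be a permutation of $[n]$. An entry $\pi_i$ is a left-to-right minimum if $\pi_j>\pi_i$ for all $j<i$. Let the left-to-right minima of $\pi$ be at positions $k_1<k_2<\dots<k_a$ (so $\pi_{k_1}>\dots>\pi_{k_a}$), and set $\pi_{k_0}:=n+1$ and $k_{a+1}:=n+1$. The staircase grid $B_a$ consists of the boxes $(i,j)$ with $1\le i\le j\le a$, where $i$ is the row index counted from the top and $j$ is the column index counted from the left. The staircase encoding of $\pi$ fills box $(i,j)$ of $B_a$ with the number of indices $p$ with $k_j<p<k_{j+1}$ and $\pi_{k_i}<\pi_p<\pi_{k_{i-1}}$. A permutation $\pi$ contains $132$ if there are indices $p<q<r$ with $\pi_p<\pi_r<\pi_q$, and avoids $132$ otherwise. For integers $\ell\ge1$, $k\ge0$, let $J(\ell,k)$ denote the number of $132$-avoiding permutations of $[\ell]$ whose staircase encoding has exactly $k$ nonzero boxes. *)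

theory Defs
  imports Complex_Main "HOL-Combinatorics.Permutations"
begin

text \<open>A permutation of \<open>[n]\<close> is a function \<open>\<pi>\<close> with \<open>\<pi> permutes {1..n}\<close>;
  positions and values are both numbered from 1.\<close>

definition lr_min_positions :: "nat \<Rightarrow> (nat \<Rightarrow> nat) \<Rightarrow> nat set" where
  "lr_min_positions n \<pi> = {p \<in> {1..n}. \<forall>q \<in> {1..<p}. \<pi> q > \<pi> p}"

definition lr_min_count :: "nat \<Rightarrow> (nat \<Rightarrow> nat) \<Rightarrow> nat" where
  "lr_min_count n \<pi> = card (lr_min_positions n \<pi>)"

text \<open>\<open>lr_min_pos n \<pi> j\<close> is \<open>k\<^sub>j\<close>, for \<open>1 \<le> j \<le> a + 1\<close> where \<open>a = lr_min_count n \<pi>\<close>,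
  with the convention \<open>k\<^bsub>a+1\<^esub> = n + 1\<close>. The value at \<open>j = 0\<close> is never used.\<close>

definition lr_min_pos :: "nat \<Rightarrow> (nat \<Rightarrow> nat) \<Rightarrow> nat \<Rightarrow> nat" where
  "lr_min_pos n \<pi> j =
     (if j \<le> lr_min_count n \<pi> then sorted_list_of_set (lr_min_positions n \<pi>) ! (j - 1)
      else n + 1)"

text \<open>\<open>lr_min_val n \<pi> i\<close> is the value of \<open>\<pi>\<close> at \<open>k\<^sub>i\<close>, for \<open>0 \<le> i \<le> a\<close>;
  for \<open>i = 0\<close> it is \<open>n + 1\<close> by convention.\<close>

definition lr_min_val :: "nat \<Rightarrow> (nat \<Rightarrow> nat) \<Rightarrow> nat \<Rightarrow> nat" where
  "lr_min_val n \<pi> i = (if i = 0 then n + 1 else \<pi> (lr_min_pos n \<pi> i))"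

definition staircase_grid :: "nat \<Rightarrow> (nat \<times> nat) set" where
  "staircase_grid a = {(i, j). 1 \<le> i \<and> i \<le> j \<and> j \<le> a}"

definition staircase_encoding :: "nat \<Rightarrow> (nat \<Rightarrow> nat) \<Rightarrow> nat \<times> nat \<Rightarrow> nat" where
  "staircase_encoding n \<pi> = (\<lambda>(i, j).
     card {p \<in> {1..n}. lr_min_pos n \<pi> j < p \<and> p < lr_min_pos n \<pi> (j + 1) \<and>
                       lr_min_val n \<pi> i < \<pi> p \<and> \<pi> p < lr_min_val n \<pi> (i - 1)})"

definition contains_132 :: "nat \<Rightarrow> (nat \<Rightarrow> nat) \<Rightarrow> bool" where
  "contains_132 n \<pi> \<longleftrightarrow>
     (\<exists>p \<in> {1..n}. \<exists>q \<in> {1..n}. \<exists>r \<in> {1..n}. p < q \<and> q < r \<and> \<pi> p < \<pi> r \<and> \<pi> r < \<pi> q)"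

definition nonzero_boxes :: "nat \<Rightarrow> (nat \<Rightarrow> nat) \<Rightarrow> (nat \<times> nat) set" where
  "nonzero_boxes n \<pi> =
     {b \<in> staircase_grid (lr_min_count n \<pi>). staircase_encoding n \<pi> b \<noteq> 0}"

definition J :: "nat \<Rightarrow> nat \<Rightarrow> nat" where
  "J l k = card {\<pi>. \<pi> permutes {1..l} \<and> \<not> contains_132 l \<pi> \<and> card (nonzero_boxes l \<pi>) = k}"

end

theory Submission
  imports Defs "HOL-Computational_Algebra.Formal_Power_Series"
begin

text \<open>
  A 132-avoiding word with maximum \<open>n\<close> is \<open>L n R\<close> with every entry of \<open>L\<close> above every entry
  of \<open>R\<close>, so these words correspond to binary trees. The nonzero boxes of \<open>L n R\<close> are those
  of \<open>L\<close>, those of \<open>R\<close>, and the top right box of the grid of \<open>L\<close> (which receives \<open>n\<close>) if \<open>L\<close>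
  is nonempty. Hence every nonempty tree with \<open>n\<close> nodes and \<open>k\<close> nonzero boxes has excess
  \<open>2n - 3k - 1 \<ge> 0\<close>, and the claim counts the trees of excess 1. As the excess is almost additive,
  splitting off the root gives a closed system for the generating functions of small excess:
  those whose top right box is zero have a Catalan series \<open>A = x + x\<^sup>2A\<^sup>2\<close>, and the others
  have a series that is linear over it with denominator \<open>1 - 2x\<^sup>2A\<close>. With \<open>P = x\<^sup>2A\<close> one has
  \<open>P = x\<^sup>3 + P\<^sup>2\<close>, hence \<open>P' (1 - 2P) = 3x\<^sup>2\<close>, so multiplying by \<open>P'\<close> removes this denominator
  and the coefficients can be read off.
\<close>

unbundle fps_syntax

section \<open>Words avoiding 132 and binary trees\<close>

text \<open>A 132 pattern led by \<open>a\<close> is an inversion among the later entries above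
  \<open>a\<close>, so its absence is a sortedness condition.\<close>

fun avoids_132 :: "nat list \<Rightarrow> bool" where
  "avoids_132 [] = True"
| "avoids_132 (a # w) \<longleftrightarrow> sorted (filter (\<lambda>x. a < x) w) \<and> avoids_132 w"

lemma avoids_132_map_add [simp]: "avoids_132 (map ((+) m) w) \<longleftrightarrow> avoids_132 w"
  by (induction w) (auto simp: filter_map o_def sorted_map)

text \<open>An entry \<open>y\<close> of \<open>v\<close> above an entry \<open>a\<close> of
  \<open>u\<close> would complete the pattern \<open>a\<close>, \<open>N\<close>, \<open>y\<close>.
  Without such a pair, no entry of \<open>v\<close> passes the filter of an entry of
  \<open>u\<close>.\<close>

lemma avoids_132_split_max:
  assumes "\<And>x. x \<in> set u \<union> set v \<Longrightarrow> x < N"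
  shows "avoids_132 (u @ N # v) \<longleftrightarrow>
           avoids_132 u \<and> avoids_132 v \<and> (\<forall>x \<in> set u. \<forall>y \<in> set v. y \<le> x)"
  using assms
proof (induction u)
  case Nil
  then have "filter (\<lambda>x. N < x) v = []"
    by (auto simp: filter_empty_conv dest: less_asym)
  then show ?case by simp
next
  case (Cons a u)
  have "sorted (filter (\<lambda>x. a < x) (u @ N # v)) \<longleftrightarrow>
          sorted (filter (\<lambda>x. a < x) u) \<and> (\<forall>y \<in> set v. y \<le> a)"
  proof
    assume s: "sorted (filter (\<lambda>x. a < x) (u @ N # v))"
    have "y \<le> a" if "y \<in> set v" for y
    proof (rule ccontr)
      assume "\<not> y \<le> a"
      \<comment> \<open>\<open>N\<close> passes the filter too and stands before
        \<open>y\<close>.\<close>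
      then have "N \<le> y" using s that Cons.prems by (auto simp: sorted_append)
      then show False using Cons.prems[of y] that by auto
    qed
    then show "sorted (filter (\<lambda>x. a < x) u) \<and> (\<forall>y \<in> set v. y \<le> a)"
      using s by (auto simp: sorted_append)
  next
    assume s: "sorted (filter (\<lambda>x. a < x) u) \<and> (\<forall>y \<in> set v. y \<le> a)"
    then have "filter (\<lambda>x. a < x) v = []"
      by (auto simp: filter_empty_conv dest: leD)
    then show "sorted (filter (\<lambda>x. a < x) (u @ N # v))"
      using s Cons.prems by (auto simp: sorted_append less_imp_le)
  qed
  moreover have "avoids_132 (u @ N # v) \<longleftrightarrow>
           avoids_132 u \<and> avoids_132 v \<and> (\<forall>x \<in> set u. \<forall>y \<in> set v. y \<le> x)"
    using Cons by auto
  ultimately show ?case by auto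
qed

lemma sorted_filter_map_upt:
  fixes f :: "nat \<Rightarrow> nat"
  shows "sorted (filter P (map f [m..<k])) \<longleftrightarrow>
     (\<forall>q \<in> {m..<k}. \<forall>r \<in> {m..<k}. q < r \<longrightarrow> P (f q) \<longrightarrow> P (f r) \<longrightarrow> f q \<le> f r)"
proof (induction k)
  case (Suc k)
  show ?case
  proof (cases "m \<le> k")
    case True
    then have "{m..<Suc k} = insert k {m..<k}" by auto
    then show ?thesis using True Suc by (auto simp: sorted_append)
  qed auto
qed auto

lemma avoids_132_map_upt:
  "avoids_132 (map f [m..<k]) \<longleftrightarrow>
     \<not> (\<exists>p \<in> {m..<k}. \<exists>q \<in> {m..<k}. \<exists>r \<in> {m..<k}. p < q \<and> q < r \<and> f p < f r \<and> f r < f q)"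
proof (induction "k - m" arbitrary: m)
  case (Suc d)
  then have mk: "m < k" by simp
  then have *: "[m..<k] = m # [Suc m..<k]" "{m..<k} = insert m {Suc m..<k}"
    by (auto simp: upt_conv_Cons)
  have IH: "avoids_132 (map f [Suc m..<k]) \<longleftrightarrow>
     \<not> (\<exists>p \<in> {Suc m..<k}. \<exists>q \<in> {Suc m..<k}. \<exists>r \<in> {Suc m..<k}. p < q \<and> q < r \<and> f p < f r \<and> f r < f q)"
    using Suc by (intro Suc.hyps(1)) auto
  have "avoids_132 (map f [m..<k]) \<longleftrightarrow>
     (\<forall>q \<in> {Suc m..<k}. \<forall>r \<in> {Suc m..<k}. q < r \<longrightarrow> f m < f q \<longrightarrow> f m < f r \<longrightarrow> f q \<le> f r) \<and>
     avoids_132 (map f [Suc m..<k])"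
    by (simp only: *(1) list.map avoids_132.simps sorted_filter_map_upt)
  also have "(\<forall>q \<in> {Suc m..<k}. \<forall>r \<in> {Suc m..<k}. q < r \<longrightarrow> f m < f q \<longrightarrow> f m < f r \<longrightarrow> f q \<le> f r) \<longleftrightarrow>
     \<not> (\<exists>q \<in> {Suc m..<k}. \<exists>r \<in> {Suc m..<k}. q < r \<and> f m < f r \<and> f r < f q)"
    by (meson less_trans not_le)
  finally show ?case unfolding IH *(2) by (auto simp: Suc_le_eq)
qed auto

section \<open>Binary trees as 132-avoiding words\<close>

datatype bt = Lf | Nd bt bt

text \<open>\<open>size\<close> counts the \<open>Nd\<close> constructors, so it is the length of
  the word. The shift by \<open>size r\<close> places the left part just above the right
  part.\<close>

fun word :: "bt \<Rightarrow> nat list" where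
  "word Lf = []"
| "word (Nd l r) = map ((+) (size r)) (word l) @ Suc (size l + size r) # word r"

lemma length_word [simp]: "length (word t) = size t"
  by (induction t) auto

lemma word_eq_Nil_iff [simp]: "word t = [] \<longleftrightarrow> t = Lf"
  by (cases t) auto

lemma set_word: "set (word t) = {1..<Suc (size t)}"
proof (induction t)
  case (Nd l r)
  have "set (word (Nd l r)) =
      (+) (size r) ` {1..<Suc (size l)} \<union> insert (Suc (size l + size r)) {1..<Suc (size r)}"
    using Nd by simp
  also have "(+) (size r) ` {1..<Suc (size l)} = {Suc (size r)..<Suc (size l + size r)}"
    by (simp add: image_add_atLeastLessThan add.commute)
  also have "{Suc (size r)..<Suc (size l + size r)} \<union>
      insert (Suc (size l + size r)) {1..<Suc (size r)} = {1..<Suc (size (Nd l r))}"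
    by auto
  finally show ?case .
qed auto

lemma distinct_word: "distinct (word t)"
  by (induction t) (auto simp: set_word distinct_map)

lemma avoids_132_word: "avoids_132 (word t)"
proof (induction t)
  case (Nd l r)
  then show ?case
    by (simp, subst avoids_132_split_max) (auto simp: set_word)
qed auto

text \<open>The maximum occurs in neither factor, so its position determines the split. Equal right
  factors give equal right subtrees, hence equal shifts on the left.\<close>

lemma word_inject: "word t = word t' \<Longrightarrow> t = t'"
proof (induction t arbitrary: t')
  case Lf
  then show ?case by (metis word_eq_Nil_iff)
next
  case (Nd l r)
  from Nd.prems have "t' \<noteq> Lf" by (metis bt.distinct(1) word_eq_Nil_iff)
  then obtain l' r' where t': "t' = Nd l' r'" by (cases t') auto
  have len: "size l + size r = size l' + size r'"
    using arg_cong[OF Nd.prems, of length] t' by simp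
  let ?N = "Suc (size l + size r)"
  have eq: "map ((+) (size r)) (word l) @ ?N # word r = map ((+) (size r')) (word l') @ ?N # word r'"
    using Nd.prems t' len by simp
  have notin: "?N \<notin> set (map ((+) (size r)) (word l))" "?N \<notin> set (word r)"
    by (auto simp: set_word)
  have "map ((+) (size r)) (word l) = map ((+) (size r')) (word l') \<and> word r = word r'"
    using eq by (subst (asm) append_Cons_eq_iff[OF notin]) auto
  then show ?case using Nd.IH t' by (auto simp: inj_map_eq_map)
qed

lemma interval_partition:
  fixes a b :: nat
  assumes un: "U \<union> V = {a..<b}" and lt: "\<And>x y. x \<in> V \<Longrightarrow> y \<in> U \<Longrightarrow> x < y"
  shows "V = {a..<a + card V} \<and> U = {a + card V..<a + card V + card U}"
proof -
  have fin: "finite U" using un by (metis finite_Un finite_atLeastLessThan)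
  obtain k where k: "V = {a..<k}" "U = {k..<b}" "a \<le> k"
  proof (cases "U = {}")
    case True
    \<comment> \<open>The maximum covers an empty interval with \<open>b < a\<close>, where
      \<open>a \<le> k\<close> must still hold.\<close>
    then show ?thesis using un by (intro that[of "max a b"]) auto
  next
    case False
    then have m: "Min U \<in> U" "\<And>y. y \<in> U \<Longrightarrow> Min U \<le> y" using fin by auto
    have mem: "x \<in> U \<or> x \<in> V \<longleftrightarrow> a \<le> x \<and> x < b" for x
      using un by (metis Un_iff atLeastLessThan_iff)
    have "V = {a..<Min U}"
    proof (intro set_eqI iffI)
      fix x assume "x \<in> V" then show "x \<in> {a..<Min U}" using lt m(1) mem by auto
    next
      fix x assume x: "x \<in> {a..<Min U}"
      then have "x \<notin> U" using m(2)[of x] by auto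
      then show "x \<in> V" using x mem[of x] mem[of "Min U"] m(1) by auto
    qed
    moreover have "U = {Min U..<b}"
    proof (intro set_eqI iffI)
      fix x assume "x \<in> U" then show "x \<in> {Min U..<b}" using m(2) mem by auto
    next
      fix x assume x: "x \<in> {Min U..<b}"
      then have "x \<notin> V" using lt[of x "Min U"] m(1) by auto
      then show "x \<in> U" using x mem[of x] mem[of "Min U"] m(1) by auto
    qed
    moreover have "a \<le> Min U" using m(1) mem by blast
    ultimately show ?thesis by (rule that)
  qed
  have "card V = k - a" "card U = b - k" using k by simp_all
  then show ?thesis using k by auto
qed

text \<open>Cutting at the maximum leaves two avoiding words, the left one above the right one, so
  each fills an interval of values and induction applies. The offset \<open>m\<close> is general
  because the left factor has offset \<open>m + length v\<close>.\<close>

lemma avoids_132_imp_word: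
  assumes "avoids_132 w" "distinct w" "set w = {Suc m..<Suc m + n}"
  shows "\<exists>t. size t = n \<and> w = map ((+) m) (word t)"
  using assms
proof (induction n arbitrary: w m rule: less_induct)
  case (less n)
  show ?case
  proof (cases "n = 0")
    case True
    then show ?thesis using less.prems by (intro exI[of _ Lf]) auto
  next
    case False
    let ?N = "m + n"
    have "?N \<in> set w" using less.prems(3) False by auto
    then obtain u v where w: "w = u @ ?N # v" by (meson split_list)
    have dist: "distinct u" "distinct v" "set u \<inter> set v = {}" "?N \<notin> set u" "?N \<notin> set v"
      using less.prems(2) w by auto
    have "set u \<union> set v = set w - {?N}" using w dist by auto
    also have "\<dots> = {Suc m..<m + n}" unfolding less.prems(3) by auto
    finally have un: "set u \<union> set v = {Suc m..<m + n}" .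
    then have "\<And>x. x \<in> set u \<union> set v \<Longrightarrow> x < ?N" by auto
    from avoids_132_split_max[OF this] less.prems(1) w
    have av: "avoids_132 u" "avoids_132 v" and le: "\<forall>x \<in> set u. \<forall>y \<in> set v. y \<le> x" by auto
    have lt: "x < y" if "x \<in> set v" "y \<in> set u" for x y
      using le that dist(3) by (metis IntI empty_iff le_neq_implies_less)
    have len: "length u + length v + 1 = n"
      using distinct_card[OF less.prems(2)] less.prems(3) w by simp
    have sets: "set v = {Suc m..<Suc m + length v}"
        "set u = {Suc (m + length v)..<Suc (m + length v) + length u}"
      using interval_partition[OF un lt] dist by (auto simp: distinct_card)
    obtain l where l: "size l = length u" "u = map ((+) (m + length v)) (word l)"
      using less.IH[OF _ av(1) dist(1) sets(2)] len by auto
    obtain r where r: "size r = length v" "v = map ((+) m) (word r)"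
      using less.IH[OF _ av(2) dist(2) sets(1)] len by auto
    have n: "n = Suc (size l + size r)" using len l(1) r(1) by simp
    have u: "u = map ((+) (m + size r)) (word l)" using l(2) r(1) by simp
    have "w = map ((+) m) (word (Nd l r))"
      unfolding w u r(2) by (simp add: n o_def add.assoc)
    then show ?thesis using n by (intro exI[of _ "Nd l r"]) simp
  qed
qed

section \<open>The statistic on words and trees\<close>

text \<open>A nonzero box is named by the values of the two left-to-right minima bounding it
  from below and from the left; for an entry \<open>c\<close> with prefix \<open>u\<close> these are the first
  value of \<open>u\<close> below \<open>c\<close> and the minimum of \<open>u\<close>.\<close>

definition box_labels :: "nat list \<Rightarrow> (nat \<times> nat) set" where
  "box_labels w =
     {(hd (filter (\<lambda>y. y < c) u), Min (set u)) | u c v. w = u @ c # v \<and> (\<exists>z \<in> set u. z < c)}"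

lemma box_labels_Nil [simp]: "box_labels [] = {}"
  by (simp add: box_labels_def)

text \<open>A label depends only on an entry and its prefix, so an appended entry keeps the old
  labels and adds at most its own.\<close>

lemma box_labels_snoc:
  "box_labels (w @ [c]) = box_labels w \<union>
     (if \<exists>z \<in> set w. z < c then {(hd (filter (\<lambda>y. y < c) w), Min (set w))} else {})"
proof -
  define Q where "Q u d x \<longleftrightarrow> x = (hd (filter (\<lambda>y. y < d) u), Min (set u)) \<and> (\<exists>z \<in> set u. z < d)"
    for u :: "nat list" and d x
  have mem: "x \<in> box_labels y \<longleftrightarrow> (\<exists>u d v. y = u @ d # v \<and> Q u d x)" for x y
    unfolding box_labels_def Q_def by blast
  have split: "w @ [c] = u @ d # v \<longleftrightarrow> (u = w \<and> d = c \<and> v = []) \<or> (\<exists>v'. v = v' @ [c] \<and> w = u @ d # v')"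
    for u d v
    by (cases v rule: rev_cases) auto
  have "x \<in> box_labels (w @ [c]) \<longleftrightarrow> x \<in> box_labels w \<or> Q w c x" for x
    unfolding mem split by blast
  then show ?thesis unfolding Q_def by auto
qed

lemma box_labels_subset: "box_labels w \<subseteq> set w \<times> set w"
proof (induction w rule: rev_induct)
  case (snoc c w)
  have "hd (filter (\<lambda>y. y < c) w) \<in> set w \<and> Min (set w) \<in> set w" if "\<exists>z \<in> set w. z < c"
  proof -
    have "filter (\<lambda>y. y < c) w \<noteq> []" using that by (auto simp: filter_empty_conv)
    then have "hd (filter (\<lambda>y. y < c) w) \<in> set (filter (\<lambda>y. y < c) w)" by (rule hd_in_set)
    moreover have "Min (set w) \<in> set w" using that by (intro Min_in) auto
    ultimately show ?thesis by simp
  qed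
  then show ?case using snoc by (auto simp: box_labels_snoc)
qed simp

lemma finite_box_labels [simp]: "finite (box_labels w)"
  using box_labels_subset by (rule finite_subset) simp

lemma box_labels_map_add:
  "box_labels (map ((+) m) w) = map_prod ((+) m) ((+) m) ` box_labels w"
proof (induction w rule: rev_induct)
  case (snoc c w)
  have "hd (filter (\<lambda>y. y < m + c) (map ((+) m) w)) = m + hd (filter (\<lambda>y. y < c) w) \<and>
        Min (set (map ((+) m) w)) = m + Min (set w)" if "\<exists>z \<in> set w. z < c"
  proof -
    have "filter (\<lambda>y. y < c) w \<noteq> []" using that by (auto simp: filter_empty_conv)
    moreover have "Min ((+) m ` set w) = m + Min (set w)"
      using that by (intro mono_Min_commute[symmetric]) (auto simp: mono_def)
    ultimately show ?thesis by (simp add: filter_map o_def hd_map)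
  qed
  then show ?case using snoc by (auto simp: box_labels_snoc image_Un)
qed simp

text \<open>All of \<open>u\<close> is below \<open>N\<close>, so the label of \<open>N\<close>
  consists of the first and the least entry of \<open>u\<close>. Entries of \<open>v\<close> lie
  below \<open>u\<close> and \<open>N\<close>, so their labels see only \<open>v\<close>.\<close>

lemma box_labels_split_max:
  assumes "\<And>x. x \<in> set u \<union> set v \<Longrightarrow> x < N" "\<And>x y. x \<in> set u \<Longrightarrow> y \<in> set v \<Longrightarrow> y < x"
  shows "box_labels (u @ N # v) =
           box_labels u \<union> (if u = [] then {} else {(hd u, Min (set u))}) \<union> box_labels v"
  using assms
proof (induction v rule: rev_induct)
  case Nil
  then have "filter (\<lambda>y. y < N) u = u" by (auto simp: filter_id_conv)
  then show ?case using Nil by (auto simp: box_labels_snoc dest: hd_in_set)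
next
  case (snoc c v)
  have IH: "box_labels (u @ N # v) =
           box_labels u \<union> (if u = [] then {} else {(hd u, Min (set u))}) \<union> box_labels v"
    using snoc by auto
  have c: "c < N" "\<And>x. x \<in> set u \<Longrightarrow> c < x" using snoc.prems by auto
  have f: "filter (\<lambda>y. y < c) u = []" using c by (auto simp: filter_empty_conv dest: less_asym)
  have ex: "(\<exists>z \<in> set (u @ N # v). z < c) \<longleftrightarrow> (\<exists>z \<in> set v. z < c)"
    using c by (auto dest: less_asym)
  have mn: "Min (set (u @ N # v)) = Min (set v)" if "\<exists>z \<in> set v. z < c"
  proof (rule Min_eqI)
    have v: "Min (set v) \<in> set v" using that by (intro Min_in) auto
    show "Min (set v) \<in> set (u @ N # v)" using v by simp
    fix y assume "y \<in> set (u @ N # v)"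
    then show "Min (set v) \<le> y"
      using v snoc.prems(1)[of "Min (set v)"] snoc.prems(2)[of y "Min (set v)"] by auto
  qed auto
  have "box_labels (u @ N # v @ [c]) = box_labels ((u @ N # v) @ [c])" by simp
  also have "\<dots> = box_labels (u @ N # v) \<union>
      (if \<exists>z \<in> set v. z < c then {(hd (filter (\<lambda>y. y < c) v), Min (set v))} else {})"
    unfolding box_labels_snoc ex using mn f c(1) by auto
  finally show ?case unfolding IH box_labels_snoc by (simp add: Un_assoc)
qed

text \<open>\<open>full t\<close> says that the top right box of the encoding is nonzero, so that inserting a
  new maximum right after the word does not create a new nonzero box.\<close>

fun full :: "bt \<Rightarrow> bool" where
  "full Lf \<longleftrightarrow> False"
| "full (Nd l r) \<longleftrightarrow> l \<noteq> Lf \<and> r = Lf"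

text \<open>The last summand is the box receiving the maximum: there is none if \<open>l\<close> is
  empty, and it is already counted if \<open>full l\<close>.\<close>

fun boxes :: "bt \<Rightarrow> nat" where
  "boxes Lf = 0"
| "boxes (Nd l r) = boxes l + boxes r + (if l = Lf \<or> full l then 0 else 1)"

text \<open>The pair of head and minimum labels the top right box. Its membership is carried through
  the induction because it decides whether a root above the tree adds a box.\<close>

lemma box_labels_word:
  "card (box_labels (word t)) = boxes t \<and>
   (t \<noteq> Lf \<longrightarrow> (hd (word t), Min (set (word t))) \<in> box_labels (word t) \<longleftrightarrow> full t)"
proof (induction t)
  case (Nd l r)
  let ?u = "map ((+) (size r)) (word l)" and ?N = "Suc (size l + size r)"
  let ?f = "map_prod ((+) (size r)) ((+) (size r)) :: nat \<times> nat \<Rightarrow> nat \<times> nat"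
  have inj: "inj ?f" by (auto simp: inj_on_def)
  have lab: "box_labels (word (Nd l r)) =
      box_labels ?u \<union> (if ?u = [] then {} else {(hd ?u, Min (set ?u))}) \<union> box_labels (word r)"
    unfolding word.simps by (rule box_labels_split_max) (auto simp: set_word)
  have u: "set ?u = {Suc (size r)..<Suc (size l + size r)}"
    by (simp add: set_word image_add_atLeastLessThan add.commute)
  have disj: "set ?u \<inter> set (word r) = {}"
    unfolding u by (auto simp: set_word)
  have card_u: "card (box_labels ?u) = boxes l"
    using Nd by (simp add: box_labels_map_add card_image inj_on_subset[OF inj])
  have mem: "(hd ?u, Min (set ?u)) \<in> box_labels ?u \<longleftrightarrow> full l" if "l \<noteq> Lf"
  proof -
    have "Min ((+) (size r) ` set (word l)) = size r + Min (set (word l))"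
      using that by (intro mono_Min_commute[symmetric]) (auto simp: mono_def)
    then have "(hd ?u, Min (set ?u)) = ?f (hd (word l), Min (set (word l)))"
      using that by (simp add: hd_map)
    then have "(hd ?u, Min (set ?u)) \<in> box_labels ?u \<longleftrightarrow>
        (hd (word l), Min (set (word l))) \<in> box_labels (word l)"
      using inj by (metis box_labels_map_add inj_image_mem_iff)
    then show ?thesis using Nd that by simp
  qed
  let ?U = "box_labels ?u \<union> (if ?u = [] then {} else {(hd ?u, Min (set ?u))})"
  have Usub: "?U \<subseteq> set ?u \<times> set ?u"
    using box_labels_subset[of ?u] by (auto intro!: Min_in simp del: set_map)
  have Rsub: "box_labels (word r) \<subseteq> set (word r) \<times> set (word r)"
    by (rule box_labels_subset)
  \<comment> \<open>The labels of the two factors are pairs over disjoint sets of values.\<close>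
  have "card (box_labels (word (Nd l r))) = card ?U + card (box_labels (word r))"
    unfolding lab
  proof (rule card_Un_disjoint)
    show "?U \<inter> box_labels (word r) = {}" using Usub Rsub disj by blast
  qed auto
  also have "card ?U = boxes l + (if l = Lf \<or> full l then 0 else 1)"
    using card_u mem by (cases "l = Lf") (auto simp: card_insert_if)
  finally have card: "card (box_labels (word (Nd l r))) = boxes (Nd l r)"
    using Nd by simp
  have Min1: "Min (set (word (Nd l r))) = 1"
    unfolding set_word by (rule Min_eqI) auto
  have "(hd (word (Nd l r)), Min (set (word (Nd l r)))) \<in> box_labels (word (Nd l r)) \<longleftrightarrow>
      l \<noteq> Lf \<and> r = Lf"
  proof (cases "l = Lf")
    case True
    then have "hd (word (Nd l r)) \<notin> set (word r)" by (simp add: set_word)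
    then show ?thesis using True lab Rsub by auto
  next
    case False
    then have hd: "hd (word (Nd l r)) = hd ?u" by simp
    have hd_u: "hd ?u \<in> set ?u" using False by (intro hd_in_set) simp
    show ?thesis
    proof (cases "r = Lf")
      case True
      \<comment> \<open>Here the pair in question is the label of the maximum \<open>?N\<close>
        itself.\<close>
      have "set (word (Nd l r)) = insert ?N (set ?u)" using True by simp
      moreover have "Min (insert ?N (set ?u)) = Min (set ?u)"
      proof -
        have "set ?u \<noteq> {}" using False by simp
        then have "Min (set ?u) \<in> set ?u" by (intro Min_in) auto
        then have "Min (set ?u) \<le> ?N" unfolding u by auto
        then show ?thesis using \<open>set ?u \<noteq> {}\<close> by (subst Min_insert) auto
      qed
      ultimately show ?thesis unfolding lab hd using True False by simp
    next
      case r: False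
      \<comment> \<open>The minimum 1 lies in \<open>word r\<close> and the head in
        \<open>?u\<close>, but no label mixes the two factors.\<close>
      then have "1 \<notin> set ?u" unfolding u by (cases r) auto
      then show ?thesis unfolding Min1 hd lab using hd_u disj Usub Rsub r by blast
    qed
  qed
  then show ?case using card by simp
qed simp

section \<open>The staircase encoding in terms of box labels\<close>

lemma box_labels_map_upt:
  "box_labels (map \<pi> [1..<Suc n]) =
     (\<lambda>p. (hd (filter (\<lambda>y. y < \<pi> p) (map \<pi> [1..<p])), Min (\<pi> ` {1..<p}))) `
       {p \<in> {1..n}. \<exists>q \<in> {1..<p}. \<pi> q < \<pi> p}"
proof (induction n)
  case (Suc n)
  have "{p \<in> {1..Suc n}. \<exists>q \<in> {1..<p}. \<pi> q < \<pi> p} =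
      {p \<in> {1..n}. \<exists>q \<in> {1..<p}. \<pi> q < \<pi> p} \<union>
      (if \<exists>q \<in> {1..<Suc n}. \<pi> q < \<pi> (Suc n) then {Suc n} else {})"
    by (auto simp: le_Suc_eq)
  moreover have "box_labels (map \<pi> [1..<Suc (Suc n)]) = box_labels (map \<pi> [1..<Suc n] @ [\<pi> (Suc n)])"
    by simp
  ultimately show ?case using Suc
    by (simp only: box_labels_snoc image_Un) (simp del: upt_Suc)
qed simp

lemma hd_filter_map_upt:
  assumes "q \<in> {1..<p}" "P (f q)" "\<And>q'. q' \<in> {1..<q} \<Longrightarrow> \<not> P (f q')"
  shows "hd (filter P (map f [1..<p])) = f q"
proof -
  have "[1..<p] = [1..<q] @ q # [Suc q..<p]"
    using assms(1) upt_add_eq_append[of 1 q "p - q"] by (auto simp: upt_conv_Cons)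
  moreover have "filter P (map f [1..<q]) = []"
    using assms(3) by (auto simp: filter_empty_conv)
  ultimately show ?thesis using assms(2) by simp
qed

section \<open>Left-to-right minima of a permutation and the entries in their boxes\<close>

context
  fixes n :: nat and \<pi> :: "nat \<Rightarrow> nat"
  assumes perm: "\<pi> permutes {1..n}"
begin

private abbreviation "M \<equiv> lr_min_positions n \<pi>"
private abbreviation "a \<equiv> lr_min_count n \<pi>"
private abbreviation "pos \<equiv> lr_min_pos n \<pi>"
private abbreviation "val \<equiv> lr_min_val n \<pi>"

lemma finite_lr_min_positions: "finite M"
  by (simp add: lr_min_positions_def)

lemma lr_min_pos_in: "1 \<le> j \<Longrightarrow> j \<le> a \<Longrightarrow> pos j \<in> M"
  using finite_lr_min_positions unfolding lr_min_pos_def lr_min_count_def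
  by (metis One_nat_def Suc_le_eq Suc_pred length_sorted_list_of_set not_less_eq_eq nth_mem
      set_sorted_list_of_set)

lemma lr_min_pos_surj: "p \<in> M \<Longrightarrow> \<exists>j. 1 \<le> j \<and> j \<le> a \<and> pos j = p"
proof -
  assume "p \<in> M"
  then have "p \<in> set (sorted_list_of_set M)" using finite_lr_min_positions by simp
  then obtain m where "m < length (sorted_list_of_set M)" "sorted_list_of_set M ! m = p"
    by (metis in_set_conv_nth)
  then show ?thesis
    by (intro exI[of _ "Suc m"]) (auto simp: lr_min_pos_def lr_min_count_def)
qed

lemma lr_min_pos_less:
  assumes "1 \<le> j" "j < j'" "j' \<le> a + 1"
  shows "pos j < pos j'"
proof (cases "j' \<le> a")
  case True
  then show ?thesis
    using assms strict_sorted_list_of_set[of M]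
    unfolding lr_min_pos_def lr_min_count_def sorted_wrt_iff_nth_less by auto
next
  case False
  then have "pos j' = n + 1" by (simp add: lr_min_pos_def)
  moreover have "pos j \<in> M" using assms by (intro lr_min_pos_in) auto
  ultimately show ?thesis by (auto simp: lr_min_positions_def)
qed

lemma lr_min_val_less:
  assumes "j < j'" "j' \<le> a"
  shows "val j' < val j"
proof -
  have M: "pos j' \<in> M" using assms by (intro lr_min_pos_in) auto
  show ?thesis
  proof (cases "j = 0")
    case True
    have "\<pi> (pos j') \<in> {1..n}"
      using M permutes_in_image[OF perm] by (auto simp: lr_min_positions_def)
    then show ?thesis using True assms by (auto simp: lr_min_val_def)
  next
    case False
    then have "pos j \<in> {1..<pos j'}"
      using lr_min_pos_less[of j j'] lr_min_pos_in[of j] assms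
      by (auto simp: lr_min_positions_def)
    then show ?thesis using M False assms by (auto simp: lr_min_positions_def lr_min_val_def)
  qed
qed

text \<open>The least value at positions 1 to \<open>q\<close> is taken at a left-to-right minimum,
  which is one of the first \<open>j\<close>. For \<open>j = 0\<close> the claim is vacuous, as
  \<open>pos 1\<close> is 1.\<close>

lemma lr_min_val_le:
  assumes "j \<le> a" "1 \<le> q" "q < pos (j + 1)"
  shows "val j \<le> \<pi> q"
proof -
  have q: "q \<le> n"
  proof (cases "j = a")
    case True
    then show ?thesis using assms by (simp add: lr_min_pos_def)
  next
    case False
    then have "pos (j + 1) \<in> M" using assms by (intro lr_min_pos_in) auto
    then show ?thesis using assms by (auto simp: lr_min_positions_def)
  qed
  have "Min (\<pi> ` {1..q}) \<in> \<pi> ` {1..q}" using assms by (intro Min_in) auto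
  then obtain m where m: "m \<in> {1..q}" "\<pi> m = Min (\<pi> ` {1..q})" by auto
  have le: "\<pi> m \<le> \<pi> x" if "x \<in> {1..q}" for x using that m(2) by simp
  have "m \<in> M"
    unfolding lr_min_positions_def
  proof (intro CollectI conjI ballI)
    show "m \<in> {1..n}" using m(1) q by auto
    fix x assume x: "x \<in> {1..<m}"
    then have "\<pi> x \<noteq> \<pi> m" using permutes_inj[OF perm] by (auto dest: injD)
    moreover have "\<pi> m \<le> \<pi> x" using x m(1) by (intro le) auto
    ultimately show "\<pi> m < \<pi> x" by simp
  qed
  then obtain j' where j': "1 \<le> j'" "j' \<le> a" "pos j' = m" using lr_min_pos_surj by blast
  have "j' \<le> j"
  proof (rule ccontr)
    assume "\<not> j' \<le> j"
    then have "j' = j + 1 \<or> pos (j + 1) < pos j'"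
      using lr_min_pos_less[of "j + 1" j'] j' by linarith
    then show False using m(1) j'(3) assms(3) by auto
  qed
  then have "val j \<le> val j'" using lr_min_val_less[of j' j] assms(1) by (cases "j' = j") auto
  also have "val j' \<le> \<pi> q" using j' le[of q] assms(2) by (auto simp: lr_min_val_def)
  finally show ?thesis .
qed

text \<open>Values before \<open>pos i\<close> are at least \<open>val (i - 1)\<close>, hence above
  \<open>\<pi> p\<close>, so the first smaller one is at \<open>pos i\<close>. No value before
  \<open>pos (j + 1)\<close> is below \<open>val j\<close>.\<close>

lemma box_entry_labels:
  assumes ij: "1 \<le> i" "i \<le> j" "j \<le> a"
    and p: "pos j < p" "p < pos (j + 1)" and v: "val i < \<pi> p" "\<pi> p < val (i - 1)"
  shows "\<exists>q \<in> {1..<p}. \<pi> q < \<pi> p"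
    and "hd (filter (\<lambda>y. y < \<pi> p) (map \<pi> [1..<p])) = val i"
    and "Min (\<pi> ` {1..<p}) = val j"
proof -
  have "1 \<le> pos i" "1 \<le> pos j" using lr_min_pos_in[of i] lr_min_pos_in[of j] ij
    by (auto simp: lr_min_positions_def)
  moreover have "pos i \<le> pos j" using lr_min_pos_less[of i j] ij by (cases "i = j") auto
  ultimately have q: "pos i \<in> {1..<p}" "pos j \<in> {1..<p}" using p by auto
  have vals: "\<pi> (pos i) = val i" "\<pi> (pos j) = val j" using ij by (auto simp: lr_min_val_def)
  show "\<exists>q \<in> {1..<p}. \<pi> q < \<pi> p" using q vals v by (intro bexI[of _ "pos i"]) auto
  have "hd (filter (\<lambda>y. y < \<pi> p) (map \<pi> [1..<p])) = \<pi> (pos i)"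
  proof (rule hd_filter_map_upt[OF q(1)])
    show "\<pi> (pos i) < \<pi> p" using vals v by simp
    fix q' assume "q' \<in> {1..<pos i}"
    then have "val (i - 1) \<le> \<pi> q'" using ij by (intro lr_min_val_le) auto
    then show "\<not> \<pi> q' < \<pi> p" using v by simp
  qed
  then show "hd (filter (\<lambda>y. y < \<pi> p) (map \<pi> [1..<p])) = val i" using vals by simp
  show "Min (\<pi> ` {1..<p}) = val j"
  proof (rule Min_eqI)
    show "val j \<in> \<pi> ` {1..<p}" using q(2) vals(2) by (metis image_eqI)
    fix y assume "y \<in> \<pi> ` {1..<p}"
    then show "val j \<le> y" using lr_min_val_le[of j] ij p by auto
  qed simp
qed

text \<open>The column comes from the last minimum before \<open>p\<close>, the row from the first
  minimum with value below \<open>\<pi> p\<close>. The former already lies below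
  \<open>\<pi> p\<close>, whence \<open>i \<le> j\<close>.\<close>

lemma non_minimum_in_box:
  assumes p: "p \<in> {1..n}" and ex: "\<exists>q \<in> {1..<p}. \<pi> q < \<pi> p"
  shows "\<exists>i j. 1 \<le> i \<and> i \<le> j \<and> j \<le> a \<and> pos j < p \<and> p < pos (j + 1) \<and>
           val i < \<pi> p \<and> \<pi> p < val (i - 1)"
proof -
  have pM: "p \<notin> M" using ex by (auto simp: lr_min_positions_def dest: less_asym)
  have ne: "pos m \<noteq> p" if "1 \<le> m" "m \<le> a" for m using lr_min_pos_in[OF that] pM by auto
  have "1 \<in> M" using p by (auto simp: lr_min_positions_def)
  then obtain j1 where j1: "1 \<le> j1" "j1 \<le> a" "pos j1 = 1" using lr_min_pos_surj by blast
  define j where "j = (GREATEST j. 1 \<le> j \<and> j \<le> a \<and> pos j < p)"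
  have "1 < p" using ex by auto
  then have j: "1 \<le> j \<and> j \<le> a \<and> pos j < p"
    unfolding j_def by (rule_tac GreatestI_nat[where k = j1 and b = a]) (use j1 in auto)
  have jmax: "j' \<le> j" if "1 \<le> j'" "j' \<le> a" "pos j' < p" for j'
    unfolding j_def by (rule Greatest_le_nat[where b = a]) (use that in auto)
  have upper: "p < pos (j + 1)"
  proof (cases "j = a")
    case True
    then show ?thesis using p by (simp add: lr_min_pos_def)
  next
    case False
    then show ?thesis using jmax[of "j + 1"] ne[of "j + 1"] j by fastforce
  qed
  obtain q where q: "q \<in> {1..<p}" "\<pi> q < \<pi> p" using ex by blast
  have "val j \<le> \<pi> q" using q upper j by (intro lr_min_val_le) auto
  then have vj: "val j < \<pi> p" using q by simp
  define i where "i = (LEAST i. 1 \<le> i \<and> val i < \<pi> p)"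
  have i: "1 \<le> i \<and> val i < \<pi> p" unfolding i_def by (rule LeastI[where k = j]) (use j vj in simp)
  have imin: "i \<le> m" if "1 \<le> m" "val m < \<pi> p" for m
    unfolding i_def by (rule Least_le) (use that in simp)
  have ij: "i \<le> j" using imin j vj by blast
  have "\<pi> p < val (i - 1)"
  proof (cases "i = 1")
    case True
    then show ?thesis using permutes_in_image[OF perm, of p] p by (simp add: lr_min_val_def)
  next
    case False
    then have "\<not> (1 \<le> i - 1 \<and> val (i - 1) < \<pi> p)" using imin[of "i - 1"] i by linarith
    then have "\<pi> p \<le> val (i - 1)" using i False by auto
    moreover have "val (i - 1) = \<pi> (pos (i - 1))" using i False by (simp add: lr_min_val_def)
    moreover have "pos (i - 1) \<noteq> p" using i False ij j by (intro ne) auto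
    ultimately show ?thesis using permutes_inj[OF perm] by (metis injD le_neq_implies_less)
  qed
  then show ?thesis using i ij j upper by blast
qed

text \<open>The values of the minima strictly decrease, so naming a box by values instead of indices
  is injective; any entry of a nonzero box produces its name.\<close>

lemma card_nonzero_boxes:
  "card (nonzero_boxes n \<pi>) = card (box_labels (map \<pi> [1..<Suc n]))"
proof -
  let ?f = "map_prod val val :: nat \<times> nat \<Rightarrow> nat \<times> nat"
  have box: "(i, j) \<in> nonzero_boxes n \<pi> \<longleftrightarrow> 1 \<le> i \<and> i \<le> j \<and> j \<le> a \<and>
      (\<exists>p \<in> {1..n}. pos j < p \<and> p < pos (j + 1) \<and> val i < \<pi> p \<and> \<pi> p < val (i - 1))" for i j
    unfolding nonzero_boxes_def staircase_grid_def staircase_encoding_def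
    by (auto simp: card_gt_0_iff)
  have "inj_on ?f (nonzero_boxes n \<pi>)"
  proof (rule inj_onI)
    have eq: "i = i'" if "val i = val i'" "i \<le> a" "i' \<le> a" for i i'
      using lr_min_val_less[of i i'] lr_min_val_less[of i' i] that by (metis less_irrefl nat_neq_iff)
    fix x y assume xy: "x \<in> nonzero_boxes n \<pi>" "y \<in> nonzero_boxes n \<pi>" "?f x = ?f y"
    obtain i j i' j' where "x = (i, j)" "y = (i', j')" by (cases x; cases y)
    then show "x = y" using xy box eq by auto
  qed
  moreover have "?f ` nonzero_boxes n \<pi> = box_labels (map \<pi> [1..<Suc n])"
    unfolding box_labels_map_upt
  proof (intro equalityI subsetI)
    fix x assume "x \<in> ?f ` nonzero_boxes n \<pi>"
    then obtain i j p where x: "x = (val i, val j)" "1 \<le> i" "i \<le> j" "j \<le> a" "p \<in> {1..n}"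
      "pos j < p" "p < pos (j + 1)" "val i < \<pi> p" "\<pi> p < val (i - 1)"
      using box by auto
    note * = box_entry_labels[OF x(2-4,6-9)]
    show "x \<in> (\<lambda>p. (hd (filter (\<lambda>y. y < \<pi> p) (map \<pi> [1..<p])), Min (\<pi> ` {1..<p}))) `
       {p \<in> {1..n}. \<exists>q \<in> {1..<p}. \<pi> q < \<pi> p}"
      by (rule image_eqI[of _ _ p]) (use * x in auto)
  next
    fix x assume "x \<in> (\<lambda>p. (hd (filter (\<lambda>y. y < \<pi> p) (map \<pi> [1..<p])), Min (\<pi> ` {1..<p}))) `
       {p \<in> {1..n}. \<exists>q \<in> {1..<p}. \<pi> q < \<pi> p}"
    then obtain p where p: "p \<in> {1..n}" "\<exists>q \<in> {1..<p}. \<pi> q < \<pi> p"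
      "x = (hd (filter (\<lambda>y. y < \<pi> p) (map \<pi> [1..<p])), Min (\<pi> ` {1..<p}))" by blast
    obtain i j where ij: "1 \<le> i" "i \<le> j" "j \<le> a" "pos j < p" "p < pos (j + 1)"
      "val i < \<pi> p" "\<pi> p < val (i - 1)" using non_minimum_in_box[OF p(1,2)] by blast
    have "(i, j) \<in> nonzero_boxes n \<pi>" using box ij p(1) by blast
    then show "x \<in> ?f ` nonzero_boxes n \<pi>"
      using box_entry_labels[OF ij] p(3) by (intro image_eqI[of _ _ "(i, j)"]) auto
  qed
  ultimately show ?thesis by (metis card_image)
qed

end

text \<open>One-line notation and \<open>word\<close> are both injective, and on the two sets they
  have the same image.\<close>

lemma J_eq_card_trees: "J l k = card {t. size t = l \<and> boxes t = k}"
proof -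
  let ?f = "\<lambda>\<pi> :: nat \<Rightarrow> nat. map \<pi> [1..<Suc l]"
  let ?S = "{\<pi>. \<pi> permutes {1..l} \<and> \<not> contains_132 l \<pi> \<and> card (nonzero_boxes l \<pi>) = k}"
  let ?T = "{t. size t = l \<and> boxes t = k}"
  have av: "avoids_132 (?f \<pi>) \<longleftrightarrow> \<not> contains_132 l \<pi>" for \<pi>
    unfolding avoids_132_map_upt contains_132_def atLeastLessThanSuc_atLeastAtMost ..
  have "inj_on ?f ?S"
  proof (rule inj_onI, rule ext)
    fix \<pi> \<rho> x assume *: "\<pi> \<in> ?S" "\<rho> \<in> ?S" "?f \<pi> = ?f \<rho>"
    show "\<pi> x = \<rho> x"
    proof (cases "x \<in> {1..l}")
      case True
      then have "x \<in> set [1..<Suc l]" by auto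
      then show ?thesis using *(3) by (metis map_eq_conv)
    next
      case False
      moreover have "\<pi> permutes {1..l}" "\<rho> permutes {1..l}" using *(1,2) by blast+
      ultimately show ?thesis by (metis permutes_not_in)
    qed
  qed
  moreover have "?f ` ?S = word ` ?T"
  proof (intro equalityI subsetI)
    fix w assume "w \<in> ?f ` ?S"
    then obtain \<pi> where \<pi>: "\<pi> \<in> ?S" "w = ?f \<pi>" by blast
    then have perm: "\<pi> permutes {1..l}" by simp
    have "set w = {Suc 0..<Suc 0 + l}"
      using permutes_image[OF perm] \<pi>(2) by (simp add: atLeastLessThanSuc_atLeastAtMost del: upt_Suc)
    moreover have "distinct w"
      using \<pi>(2) permutes_inj_on[OF perm] by (simp add: distinct_map del: upt_Suc)
    moreover have "avoids_132 w" unfolding \<pi>(2) av using \<pi>(1) by blast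
    ultimately obtain t where t: "size t = l" "w = map ((+) 0) (word t)"
      using avoids_132_imp_word[of w 0 l] by auto
    have "w = word t" unfolding t(2) by (simp add: map_idI)
    moreover have "boxes t = k"
    proof -
      have "card (nonzero_boxes l \<pi>) = k" using \<pi>(1) by blast
      then have "card (box_labels w) = k" unfolding \<pi>(2) card_nonzero_boxes[OF perm] .
      then show ?thesis unfolding \<open>w = word t\<close> using box_labels_word[of t] by simp
    qed
    ultimately show "w \<in> word ` ?T" using t(1) by blast
  next
    fix w assume "w \<in> word ` ?T"
    then obtain t where t: "size t = l" "boxes t = k" "w = word t" by auto
    \<comment> \<open>List indices start at 0, and \<open>permutes\<close> demands the identity
      outside \<open>{1..l}\<close>.\<close>
    define \<pi> where "\<pi> = (\<lambda>x. if x \<in> {1..l} then w ! (x - 1) else x)"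
    have w: "w = ?f \<pi>"
      by (rule nth_equalityI) (auto simp: t(1,3) \<pi>_def simp del: upt_Suc)
    have "distinct (?f \<pi>)" "set (?f \<pi>) = {1..l}"
      using distinct_word[of t] set_word[of t] t(1)
      unfolding w[symmetric] t(3) by (simp_all add: atLeastLessThanSuc_atLeastAtMost)
    then have "inj_on \<pi> {1..l}" "\<pi> ` {1..l} = {1..l}"
      by (simp_all add: distinct_map atLeastLessThanSuc_atLeastAtMost del: upt_Suc)
    then have "bij_betw \<pi> {1..l} {1..l}" by (simp add: bij_betw_def)
    then have perm: "\<pi> permutes {1..l}"
      by (rule bij_imp_permutes) (auto simp: \<pi>_def)
    have "card (nonzero_boxes l \<pi>) = k"
      unfolding card_nonzero_boxes[OF perm] w[symmetric] t(3)
      using box_labels_word[of t] t(2) by simp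
    moreover have "\<not> contains_132 l \<pi>"
      unfolding av[symmetric] w[symmetric] t(3) by (simp add: avoids_132_word)
    ultimately have "\<pi> \<in> ?S" using perm by simp
    then show "w \<in> ?f ` ?S" by (rule image_eqI[where f = ?f, OF w])
  qed
  ultimately have "card ?S = card (word ` ?T)" using card_image[of ?f ?S] by argo
  also have "\<dots> = card ?T"
    by (rule card_image) (auto intro: inj_onI word_inject)
  finally show ?thesis unfolding J_def .
qed

section \<open>Counting trees of excess one\<close>

definition bt_gf :: "bt set \<Rightarrow> real fps" where
  "bt_gf P = Abs_fps (\<lambda>n. real (card {t \<in> P. size t = n}))"

definition Nds :: "bt set \<Rightarrow> bt set \<Rightarrow> bt set" where
  "Nds P Q = case_prod Nd ` (P \<times> Q)"

lemma Nd_in_Nds [simp]: "Nd l r \<in> Nds P Q \<longleftrightarrow> l \<in> P \<and> r \<in> Q"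
  by (auto simp: Nds_def)

lemma Lf_notin_Nds [simp]: "Lf \<notin> Nds P Q"
  by (auto simp: Nds_def)

lemma finite_trees_size: "finite {t :: bt. size t = n}"
proof -
  have "finite {t :: bt. size t \<le> n}"
  proof (induction n)
    case 0
    have "{t :: bt. size t \<le> 0} \<subseteq> {Lf}"
    proof
      fix t :: bt assume "t \<in> {t. size t \<le> 0}"
      then show "t \<in> {Lf}" by (cases t) auto
    qed
    then show ?case by (rule finite_subset) simp
  next
    case (Suc n)
    have "{t :: bt. size t \<le> Suc n} \<subseteq> insert Lf (Nds {t. size t \<le> n} {t. size t \<le> n})"
    proof
      fix t :: bt assume "t \<in> {t. size t \<le> Suc n}"
      then show "t \<in> insert Lf (Nds {t. size t \<le> n} {t. size t \<le> n})" by (cases t) auto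
    qed
    then show ?case by (rule finite_subset) (simp add: Suc Nds_def)
  qed
  then show ?thesis by (rule rev_finite_subset) auto
qed

lemma finite_trees_size' [simp]: "finite {t :: bt. t \<in> P \<and> size t = n}"
  by (rule finite_subset[OF _ finite_trees_size[of n]]) auto

lemma bt_gf_nth [simp]: "bt_gf P $ n = real (card {t \<in> P. size t = n})"
  by (simp add: bt_gf_def)

lemma bt_gf_Un: "P \<inter> Q = {} \<Longrightarrow> bt_gf (P \<union> Q) = bt_gf P + bt_gf Q"
proof (rule fps_ext)
  fix n assume "P \<inter> Q = {}"
  then have "card ({t \<in> P. size t = n} \<union> {t \<in> Q. size t = n}) =
      card {t \<in> P. size t = n} + card {t \<in> Q. size t = n}"
    by (intro card_Un_disjoint) auto
  moreover have "{t \<in> P \<union> Q. size t = n} = {t \<in> P. size t = n} \<union> {t \<in> Q. size t = n}" by auto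
  ultimately show "bt_gf (P \<union> Q) $ n = (bt_gf P + bt_gf Q) $ n" by simp
qed

lemma bt_gf_Lf: "bt_gf {Lf} = 1"
proof (rule fps_ext)
  fix n
  have "{t \<in> {Lf}. size t = n} = (if n = 0 then {Lf} else {})" by auto
  then show "bt_gf {Lf} $ n = 1 $ n" by simp
qed

lemma bt_gf_Nds: "bt_gf (Nds P Q) = fps_X * bt_gf P * bt_gf Q"
proof (rule fps_ext)
  fix n
  show "bt_gf (Nds P Q) $ n = (fps_X * bt_gf P * bt_gf Q) $ n"
  proof (cases n)
    case 0
    have "{t \<in> Nds P Q. size t = 0} = {}" by (auto simp: Nds_def)
    then show ?thesis using 0 by (simp add: mult.assoc)
  next
    case (Suc m)
    let ?F = "\<lambda>i. {l \<in> P. size l = i} \<times> {r \<in> Q. size r = m - i}"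
    have eq: "{t \<in> Nds P Q. size t = n} = case_prod Nd ` (\<Union>i \<in> {0..m}. ?F i)"
      using Suc by (fastforce simp: Nds_def)
    have "card {t \<in> Nds P Q. size t = n} = card (\<Union>i \<in> {0..m}. ?F i)"
      unfolding eq by (rule card_image) (auto simp: inj_on_def)
    also have "\<dots> = (\<Sum>i = 0..m. card (?F i))"
      by (rule card_UN_disjoint) auto
    finally have "bt_gf (Nds P Q) $ n = (bt_gf P * bt_gf Q) $ m"
      by (simp add: fps_mult_nth card_cartesian_product)
    then show ?thesis using Suc by (simp add: mult.assoc)
  qed
qed

text \<open>Let \<open>e\<close> be the excess. For \<open>l\<close> and \<open>r\<close> nonempty,
  \<open>e\<close> is e(l) + e(r) if \<open>l\<close> is not full and 3 more otherwise. With only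
  \<open>l\<close> nonempty it is e(l) - 1 or e(l) + 2 respectively, with only \<open>r\<close>
  nonempty e(r) + 2, and for a single node 1. So full trees have \<open>e \<ge> 0\<close> and other
  nonempty trees \<open>e \<ge> 1\<close>.\<close>

lemma excess_bounds:
  "t \<noteq> Lf \<Longrightarrow> 3 * boxes t + (if full t then 1 else 2) \<le> 2 * size t"
proof (induction t)
  case (Nd l r)
  then show ?case by (cases "l = Lf"; cases "r = Lf") (auto split: if_splits)
qed simp

definition excess_trees :: "bool \<Rightarrow> nat \<Rightarrow> bt set" where
  "excess_trees b e = {t. t \<noteq> Lf \<and> full t = b \<and> 2 * size t = 3 * boxes t + 1 + e}"

lemma in_excess_trees [simp]:
  "t \<in> excess_trees b e \<longleftrightarrow> t \<noteq> Lf \<and> full t = b \<and> 2 * size t = 3 * boxes t + 1 + e"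
  by (simp add: excess_trees_def)

text \<open>Beyond the single node, both subtrees are nonempty and \<open>l\<close> is not full, so
  the excesses are 1 and 0; excess 0 forces \<open>full r\<close>.\<close>

lemma excess_trees_not_full_1:
  "excess_trees False 1 = Nds {Lf} {Lf} \<union> Nds (excess_trees False 1) (excess_trees True 0)"
proof (rule set_eqI)
  fix t show "t \<in> excess_trees False 1 \<longleftrightarrow>
    t \<in> Nds {Lf} {Lf} \<union> Nds (excess_trees False 1) (excess_trees True 0)"
  proof (cases t)
    case (Nd l r)
    then show ?thesis using excess_bounds[of l] excess_bounds[of r]
      by (cases "l = Lf"; cases "r = Lf"; cases "full l"; cases "full r") auto
  qed simp
qed

lemma excess_trees_full_0: "excess_trees True 0 = Nds (excess_trees False 1) {Lf}"
proof (rule set_eqI)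
  fix t show "t \<in> excess_trees True 0 \<longleftrightarrow> t \<in> Nds (excess_trees False 1) {Lf}"
  proof (cases t)
    case (Nd l r)
    then show ?thesis using excess_bounds[of l] excess_bounds[of r]
      by (cases "l = Lf"; cases "r = Lf"; cases "full l"; cases "full r") auto
  qed simp
qed

lemma excess_trees_full_1: "excess_trees True 1 = Nds (excess_trees False 2) {Lf}"
proof (rule set_eqI)
  fix t show "t \<in> excess_trees True 1 \<longleftrightarrow> t \<in> Nds (excess_trees False 2) {Lf}"
  proof (cases t)
    case (Nd l r)
    then show ?thesis using excess_bounds[of l] excess_bounds[of r]
      by (cases "l = Lf"; cases "r = Lf"; cases "full l"; cases "full r") auto
  qed simp
qed

text \<open>An empty left subtree leaves excess 0 for the right one. Otherwise \<open>l\<close> is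
  not full and the excess splits as 1 + 1 or 2 + 0.\<close>

lemma excess_trees_not_full_2:
  "excess_trees False 2 = Nds {Lf} (excess_trees True 0) \<union>
     (Nds (excess_trees False 1) (excess_trees False 1 \<union> excess_trees True 1) \<union>
      Nds (excess_trees False 2) (excess_trees True 0))"
proof (rule set_eqI)
  fix t show "t \<in> excess_trees False 2 \<longleftrightarrow> t \<in> Nds {Lf} (excess_trees True 0) \<union>
     (Nds (excess_trees False 1) (excess_trees False 1 \<union> excess_trees True 1) \<union>
      Nds (excess_trees False 2) (excess_trees True 0))"
  proof (cases t)
    case (Nd l r)
    then show ?thesis using excess_bounds[of l] excess_bounds[of r]
      by (cases "l = Lf"; cases "r = Lf"; cases "full l"; cases "full r") auto
  qed simp
qed

section \<open>The equations for excess one and their solution\<close>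

definition cat_gf :: "real fps" where "cat_gf = bt_gf (excess_trees False 1)"

definition top_gf :: "real fps" where "top_gf = bt_gf (excess_trees True 1)"

lemma Nds_disjoint: "P \<inter> P' = {} \<or> Q \<inter> Q' = {} \<Longrightarrow> Nds P Q \<inter> Nds P' Q' = {}"
  by (auto simp: Nds_def)

text \<open>Eliminating the class of excess 0 leaves the equation of x C(x^3), with C the Catalan
  series.\<close>

lemma cat_gf_eq: "cat_gf = fps_X + fps_X ^ 2 * cat_gf ^ 2"
proof -
  have "cat_gf = fps_X + fps_X * cat_gf * bt_gf (excess_trees True 0)"
    unfolding cat_gf_def
    by (subst excess_trees_not_full_1, subst bt_gf_Un)
      (simp_all add: Nds_disjoint bt_gf_Nds bt_gf_Lf)
  also have "bt_gf (excess_trees True 0) = fps_X * cat_gf"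
    by (simp add: excess_trees_full_0 bt_gf_Nds bt_gf_Lf cat_gf_def)
  finally show ?thesis by (simp add: power2_eq_square mult_ac)
qed

text \<open>The factor 2 arises because the unknown enters twice: through a full right subtree of
  excess 1 and through a left subtree of excess 2.\<close>

lemma top_gf_eq:
  "top_gf * (1 - 2 * fps_X ^ 2 * cat_gf) = fps_X ^ 3 * cat_gf + fps_X ^ 2 * cat_gf ^ 2"
proof -
  let ?A = "bt_gf (excess_trees False 2)"
  have B0: "bt_gf (excess_trees True 0) = fps_X * cat_gf"
    by (simp add: excess_trees_full_0 bt_gf_Nds bt_gf_Lf cat_gf_def)
  have B1: "top_gf = fps_X * ?A"
    unfolding top_gf_def excess_trees_full_1 by (simp add: bt_gf_Nds bt_gf_Lf)
  have un: "bt_gf (excess_trees False 1 \<union> excess_trees True 1) = cat_gf + top_gf"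
    unfolding cat_gf_def top_gf_def by (rule bt_gf_Un) auto
  have d1: "Nds (excess_trees False 1) (excess_trees False 1 \<union> excess_trees True 1) \<inter>
      Nds (excess_trees False 2) (excess_trees True 0) = {}"
    by (rule Nds_disjoint) auto
  have d2: "Nds {Lf} (excess_trees True 0) \<inter>
     (Nds (excess_trees False 1) (excess_trees False 1 \<union> excess_trees True 1) \<union>
      Nds (excess_trees False 2) (excess_trees True 0)) = {}"
    unfolding Int_Un_distrib Un_empty by (intro conjI Nds_disjoint) auto
  have "?A = fps_X * bt_gf (excess_trees True 0) +
      (fps_X * cat_gf * (cat_gf + top_gf) + fps_X * ?A * bt_gf (excess_trees True 0))"
    by (subst excess_trees_not_full_2, subst bt_gf_Un[OF d2], subst bt_gf_Un[OF d1])
      (simp add: bt_gf_Nds bt_gf_Lf un cat_gf_def[symmetric] del: One_nat_def)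
  then show ?thesis unfolding B0 B1 by algebra
qed

lemma gf_identities:
  defines "P \<equiv> fps_X ^ 2 * cat_gf"
  shows "fps_deriv P * (1 - 4 * fps_X ^ 3) = 3 * fps_X ^ 2 * (1 - 2 * P)"
    and "6 * fps_X ^ 4 * top_gf =
           fps_deriv P - fps_X ^ 3 * fps_deriv P - 3 * fps_X ^ 2 - 3 * fps_X ^ 5"
proof -
  let ?X = "fps_X :: real fps" and ?Q = "fps_deriv P"
  have P: "P = ?X ^ 3 + P ^ 2"
  proof -
    have "P = ?X ^ 2 * (?X + ?X ^ 2 * cat_gf ^ 2)"
      unfolding P_def using cat_gf_eq by simp
    also have "\<dots> = ?X ^ 3 + P ^ 2" unfolding P_def by algebra
    finally show ?thesis .
  qed
  have "?Q = fps_deriv (?X ^ 3 + P ^ 2)" using P by simp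
  also have "\<dots> = 3 * ?X ^ 2 + 2 * P * ?Q"
    by (simp add: fps_deriv_power power2_eq_square power3_eq_cube algebra_simps)
  finally have Q: "?Q * (1 - 2 * P) = 3 * ?X ^ 2" by (simp add: algebra_simps)
  \<comment> \<open>The quadratic equation for \<open>P\<close> says that the square of
    \<open>1 - 2 * P\<close> is \<open>1 - 4 * ?X ^ 3\<close>.\<close>
  have "?Q * (1 - 4 * ?X ^ 3) = ?Q * (1 - 2 * P) * (1 - 2 * P)"
    using P by algebra
  then show "?Q * (1 - 4 * ?X ^ 3) = 3 * ?X ^ 2 * (1 - 2 * P)" by (simp only: Q)
  have "top_gf * (1 - 2 * P) = ?X ^ 3 * cat_gf + ?X ^ 2 * cat_gf ^ 2"
    using top_gf_eq by (simp add: P_def mult.assoc)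
  then have "?X ^ 2 * (top_gf * (1 - 2 * P)) = ?X ^ 3 * P + P ^ 2"
    unfolding P_def by algebra
  \<comment> \<open>Multiplication by \<open>2 * ?Q\<close> turns the denominator into
    \<open>3 * ?X ^ 2\<close>. The next two equations make the right-hand side linear in
    \<open>?Q\<close>.\<close>
  then have "?Q * (1 - 2 * P) * (2 * ?X ^ 2 * top_gf) = 2 * (?X ^ 3 * (P * ?Q) + P ^ 2 * ?Q)"
    by algebra
  moreover have "P ^ 2 = P - ?X ^ 3" using P by algebra
  moreover have "2 * (P * ?Q) = ?Q - 3 * ?X ^ 2" using Q by algebra
  ultimately have "3 * ?X ^ 2 * (2 * ?X ^ 2 * top_gf) =
      ?X ^ 3 * (?Q - 3 * ?X ^ 2) + (?Q - 3 * ?X ^ 2) - 2 * ?X ^ 3 * ?Q"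
    unfolding Q by algebra
  then show "6 * ?X ^ 4 * top_gf = ?Q - ?X ^ 3 * ?Q - 3 * ?X ^ 2 - 3 * ?X ^ 5"
    by algebra
qed

section \<open>Reading off the coefficients\<close>

lemma fps_numeral_mult_nth: "(numeral k * f) $ n = numeral k * (f :: real fps) $ n"
  by (metis fps_mult_left_const_nth numeral_fps_const)

lemma cat_gf_1: "cat_gf $ Suc 0 = 1"
  by (subst cat_gf_eq) (simp add: fps_X_power_mult_nth)

lemma deriv_nth: "fps_deriv (fps_X ^ 2 * cat_gf) $ (Suc m) = real (m + 2) * cat_gf $ m"
  unfolding fps_deriv_nth by (simp only: fps_X_power_mult_nth) simp

text \<open>This is the Catalan recurrence. The first identity is linear in \<open>P\<close> and its
  derivative, so its coefficient at \<open>3 * i + 5\<close> links only two coefficients of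
  \<open>cat_gf\<close>.\<close>

lemma cat_gf_recurrence:
  "real (i + 2) * cat_gf $ (3 * i + 4) = real (4 * i + 2) * cat_gf $ (3 * i + 1)"
proof -
  define D where "D = fps_deriv (fps_X ^ 2 * cat_gf)"
  have "D - 4 * (fps_X ^ 3 * D) = D * (1 - 4 * fps_X ^ 3)" by algebra
  also have "\<dots> = 3 * fps_X ^ 2 * (1 - 2 * (fps_X ^ 2 * cat_gf))"
    unfolding D_def by (rule gf_identities)
  also have "\<dots> = 3 * fps_X ^ 2 - 6 * (fps_X ^ 4 * cat_gf)" by algebra
  finally have "(D - 4 * (fps_X ^ 3 * D)) $ (3 * i + 5) =
      (3 * fps_X ^ 2 - 6 * (fps_X ^ 4 * cat_gf)) $ (3 * i + 5)" by simp
  then have "D $ (3 * i + 5) - 4 * D $ (3 * i + 2) = - 6 * cat_gf $ (3 * i + 1)"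
    by (simp add: fps_numeral_mult_nth fps_X_power_mult_nth)
  moreover have "D $ (3 * i + 5) = real (3 * i + 6) * cat_gf $ (3 * i + 4)"
    using deriv_nth[of "3 * i + 4"] unfolding D_def by (simp del: fps_deriv_mult)
  moreover have "D $ (3 * i + 2) = real (3 * i + 3) * cat_gf $ (3 * i + 1)"
    using deriv_nth[of "3 * i + 1"] unfolding D_def by (simp del: fps_deriv_mult)
  ultimately show ?thesis by (simp add: algebra_simps)
qed

lemma top_gf_nth:
  assumes "i \<ge> 1"
  shows "2 * top_gf $ (3 * i + 1) =
    real (i + 2) * cat_gf $ (3 * i + 4) - real (i + 1) * cat_gf $ (3 * i + 1)"
proof -
  define D where "D = fps_deriv (fps_X ^ 2 * cat_gf)"
  have "6 * (fps_X ^ 4 * top_gf) = 6 * fps_X ^ 4 * top_gf" by (simp add: mult.assoc)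
  also have "\<dots> = D - fps_X ^ 3 * D - 3 * fps_X ^ 2 - 3 * fps_X ^ 5"
    unfolding D_def by (rule gf_identities)
  finally have "(6 * (fps_X ^ 4 * top_gf)) $ (3 * i + 5) =
      (D - fps_X ^ 3 * D - 3 * fps_X ^ 2 - 3 * fps_X ^ 5) $ (3 * i + 5)" by simp
  \<comment> \<open>For \<open>i \<ge> 1\<close> the term \<open>3 * fps_X ^ 5\<close> does not
    reach degree \<open>3 * i + 5\<close>.\<close>
  then have "6 * top_gf $ (3 * i + 1) = D $ (3 * i + 5) - D $ (3 * i + 2)"
    using assms by (simp add: fps_numeral_mult_nth fps_X_power_mult_nth)
  moreover have "D $ (3 * i + 5) = real (3 * i + 6) * cat_gf $ (3 * i + 4)"
    using deriv_nth[of "3 * i + 4"] unfolding D_def by (simp del: fps_deriv_mult)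
  moreover have "D $ (3 * i + 2) = real (3 * i + 3) * cat_gf $ (3 * i + 1)"
    using deriv_nth[of "3 * i + 1"] unfolding D_def by (simp del: fps_deriv_mult)
  ultimately show ?thesis by (simp add: algebra_simps)
qed

text \<open>Absorption is applied twice, with the symmetry of row \<open>2 * i + 1\<close> in
  between.\<close>

lemma central_binomial_Suc:
  "real (i + 1) * real ((2 * (i + 1)) choose (i + 1)) = real (4 * i + 2) * real ((2 * i) choose i)"
proof -
  have "Suc i * (Suc (Suc (2 * i)) choose Suc i) = Suc (Suc (2 * i)) * (Suc (2 * i) choose i)"
    by (rule Suc_times_binomial)
  also have "\<dots> = 2 * (Suc i * (Suc (2 * i) choose i))" by simp
  also have "Suc (2 * i) choose i = Suc (2 * i) choose Suc i"
    using binomial_symmetric[of i "Suc (2 * i)"] by (simp add: Suc_diff_le del: binomial_Suc_Suc)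
  also have "Suc i * (Suc (2 * i) choose Suc i) = Suc (2 * i) * (2 * i choose i)"
    by (rule Suc_times_binomial)
  finally have "(i + 1) * (2 * (i + 1) choose (i + 1)) = (4 * i + 2) * (2 * i choose i)"
    by (simp del: binomial_Suc_Suc)
  then show ?thesis by (metis of_nat_mult)
qed

text \<open>Both sides satisfy the same first-order recurrence and equal 1 at
  \<open>i = 0\<close>.\<close>

lemma cat_gf_nth: "real (i + 1) * cat_gf $ (3 * i + 1) = real ((2 * i) choose i)"
proof (induction i)
  case 0
  then show ?case by (simp add: cat_gf_1)
next
  case (Suc i)
  have "real (i + 1) * (real (i + 2) * cat_gf $ (3 * i + 4)) =
      real (4 * i + 2) * (real (i + 1) * cat_gf $ (3 * i + 1))"
    unfolding cat_gf_recurrence by simp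
  also have "\<dots> = real (i + 1) * real ((2 * (i + 1)) choose (i + 1))"
    unfolding Suc central_binomial_Suc ..
  finally have "real (i + 2) * cat_gf $ (3 * i + 4) = real ((2 * (i + 1)) choose (i + 1))"
    by (simp del: binomial_Suc_Suc)
  moreover have "3 * Suc i + 1 = 3 * i + 4" "Suc i + 1 = i + 2" by simp_all
  ultimately show ?case by (simp only: Suc_eq_plus1)
qed

theorem theorem2p9:
  fixes i :: nat
  assumes "i \<ge> 1"
  shows "J (3 * i + 1) (2 * i) > 0 \<and>
         real (J (3 * i + 1) (2 * i)) = 3 / 2 * real ((2 * i) choose i)"
proof -
  let ?n = "3 * i + 1"
  \<comment> \<open>At size \<open>3 * i + 1\<close>, having \<open>2 * i\<close> boxes is the same
    as having excess 1.\<close>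
  have "{t. size t = ?n \<and> boxes t = 2 * i} =
      {t \<in> excess_trees False 1 \<union> excess_trees True 1. size t = ?n}"
    by auto
  then have "real (J ?n (2 * i)) = bt_gf (excess_trees False 1 \<union> excess_trees True 1) $ ?n"
    unfolding J_eq_card_trees by simp
  also have "bt_gf (excess_trees False 1 \<union> excess_trees True 1) = cat_gf + top_gf"
    unfolding cat_gf_def top_gf_def by (rule bt_gf_Un) auto
  finally have "2 * real (J ?n (2 * i)) = 2 * cat_gf $ ?n + 2 * top_gf $ ?n" by simp
  \<comment> \<open>The factors add up to 2 + (4i + 2) - (i + 1) = 3(i + 1).\<close>
  also have "\<dots> = 3 * (real (i + 1) * cat_gf $ ?n)"
    unfolding top_gf_nth[OF assms] cat_gf_recurrence by (simp add: algebra_simps)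
  finally have "real (J ?n (2 * i)) = 3 / 2 * real ((2 * i) choose i)"
    unfolding cat_gf_nth by simp
  moreover have "(2 * i) choose i > 0" by simp
  ultimately show ?thesis by (metis mult_pos_pos of_nat_0_less_iff zero_less_divide_iff zero_less_numeral)
qed

end
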